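(* Let $\mathbb{D}$ be an $\mathbb{F}_{0}$-composable class of filters. The category $\operatorname{fix}\operatorname{A}_{\mathbb{D}}$ of $\mathbb{D}$-adherence-determined convergences is simple (in the category $\mathsf{Conv}$ of convergence spaces and continuous maps) if and only if $\mathbb{D}$ is refinable.
   Context: Filters. For a set $X$, $\mathbb{F}X$ is the set of proper filters on $X$, ordered by inclusion ($\mathcal{F}\le\mathcal{G}$ iff $\mathcal{F}\subset\mathcal{G}$), and $\overline{\mathbb{F}X}=\mathbb{F}X\cup\{\mathcal{P}(X)\}$ also includes the degenerate filter. Two families $\mathcal{A},\mathcal{B}$ of subsets of $X$ mesh, written $\mathcal{A}\#\mathcal{B}$, if $A\cap B\neq\emptyset$ for all $A\in\mathcal{A}$, $B\in\mathcal{B}$. For $x\in X$, $\{x\}^{\uparrow}$ is the principal ultrafilter of $x$. For $f:X\to Y$ and filters $\mathcal{F}$ on $X$, $\mathcal{G}$ on $Y$: $f[\mathcal{F}]=\{B\subset Y: f^{-1}(B)\in\mathcal{F}\}$, and $f^{-}[\mathcal{G}]$ is the (possibly degenerate) filter on $X$ generated by $\{f^{-1}(G):G\in\mathcal{G}\}$. Classes of filters. A class of filters $\mathbb{D}$ assigns to each set $X$ a set $\mathbb{D}X$ of filters on $X$; for a filter $\mathcal{F}$ on $X$, $\mathbb{D}(\mathcal{F})=\{\mathcal{D}\in\mathbb{D}X:\mathcal{D}\ge\mathcal{F}\}$. $\mathbb{D}$ is $\mathbb{F}_0$-composable if $\mathbb{D}X\subset\overline{\mathbb{F}X}$ for every set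 $X$, and for all sets $X,Y$, every relation $R\subset X\times Y$ and every $\mathcal{D}\in\mathbb{D}X$, the filter $R[\mathcal{D}]$ on $Y$ generated by $\{R(D):D\in\mathcal{D}\}$ (where $R(D)=\{y:\exists x\in D,\ (x,y)\in R\}$) belongs to $\mathbb{D}Y$. Such classes are understood to contain all principal filters. A class $\mathbb{D}$ of filters is refinable if there is a set $Y$ such that for every set $X$, every $\mathcal{D}\in\mathbb{D}X$ and every $\mathcal{F}\in\mathbb{F}X$ with $\mathcal{F}\#\mathcal{D}$, there are $\mathcal{L}\in\mathbb{D}(\mathcal{D})$ with $\mathcal{L}\#\mathcal{F}$ and a map $f:X\to Y$ with $\mathcal{D}\le f^{-}[f[\mathcal{L}]]$. Convergences. A convergence $\xi$ on a set $X=|\xi|$ is a relation between points $x\in X$ and filters $\mathcal{F}\in\mathbb{F}X$, written $x\in\lim_{\xi}\mathcal{F}$, such that $x\in\lim_\xi\{x\}^{\uparrow}$ for all $x\in X$, and $\lim_\xi\mathcal{F}\subset\lim_\xi\mathcal{G}$ whenever $\mathcal{F}\le\mathcal{G}$. A map $f:|\xi|\to|\tau|$ is continuous if $f(\lim_\xi\mathcal{F})\subset\lim_\tau f[\mathcal{F}]$ for all $\mathcal{F}\in\mathbb{F}|\xi|$. For $f:X\to|\tau|$, $f^{-}\tau$ is the initial convergence on $X$: $x\in\lim_{f^{-}\tau}\mathcal{F}$ iff $f(x)\in\lim_\tau f[\mathcal{F}]$. For a family $\Xi$ of convergences on $X$, $\lim_{\bigvee\Xi}\mathcal{F}=\bigcap_{\xi\in\Xi}\lim_\xi\mathcal{F}$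 (the empty supremum being the antidiscrete convergence, in which every filter converges to every point). Adherence. $\operatorname{adh}_\xi\mathcal{H}=\bigcup\{\lim_\xi\mathcal{G}:\mathcal{G}\in\mathbb{F}|\xi|,\ \mathcal{G}\ge\mathcal{H}\}$. For an $\mathbb{F}_0$-composable class $\mathbb{D}$, $\operatorname{A}_{\mathbb{D}}\xi$ is the convergence on $|\xi|$ given by $\lim_{\operatorname{A}_{\mathbb{D}}\xi}\mathcal{F}=\bigcap\{\operatorname{adh}_\xi\mathcal{D}:\mathcal{D}\in\mathbb{D}|\xi|,\ \mathcal{D}\#\mathcal{F}\}$, and $\operatorname{fix}\operatorname{A}_{\mathbb{D}}$ is the full subcategory of $\mathsf{Conv}$ of convergences $\xi$ with $\xi=\operatorname{A}_{\mathbb{D}}\xi$ (the $\mathbb{D}$-adherence-determined convergences). Simplicity. A convergence $\eta$ is initially dense in a class $\Phi$ of convergences if $\eta\in\Phi$ and for every $\xi\in\Phi$ there is a set $A$ of maps from $|\xi|$ to $|\eta|$ with $\xi=\bigvee_{f\in A}f^{-}\eta$. The category $\operatorname{fix}\operatorname{A}_{\mathbb{D}}$ is simple in $\mathsf{Conv}$ if its class of objects contains an initially dense convergence (equivalently, it is the epireflective hull in $\mathsf{Conv}$ of one of its objects). *)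

theory Defs
  imports Complex_Main "HOL-Library.FuncSet"
begin

text \<open>
  HOL cannot quantify over all types inside a formula, and a class of filters ranges over all
  sets.  The sets of the ambient set theory are therefore modelled by the members of a universe
  \<open>U\<close>: a family of (small) subsets of a type \<open>'u\<close> that is closed under the set formation
  principles of ZFC.  As the powerset of \<open>X\<close> does not live in the type \<open>'u set\<close>, the powerset
  axiom asks for a member of \<open>U\<close> in bijection with it.  By Cantor's theorem \<open>UNIV \<notin> U\<close>, so members
  of \<open>U\<close> really are small.  No axiom of infinity is imposed; the subsets of a Grothendieck universe
  that are in bijection with an element of it, as well as the finite subsets of \<open>nat\<close>, are instances.
  Classes are arbitrary functions and predicates on the members of \<open>U\<close>.
\<close>

definition universe :: "'u set set \<Rightarrow> bool" where
  "universe U \<longleftrightarrow>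
     (\<forall>x. {x} \<in> U) \<and>
     (\<forall>X\<in>U. \<forall>X'. X' \<subseteq> X \<longrightarrow> X' \<in> U) \<and>
     (\<forall>X\<in>U. \<forall>f :: 'u \<Rightarrow> 'u. f ` X \<in> U) \<and>
     (\<forall>X\<in>U. \<forall>S :: 'u \<Rightarrow> 'u set. (\<forall>x\<in>X. S x \<in> U) \<longrightarrow> (\<Union>x\<in>X. S x) \<in> U) \<and>
     (\<forall>X\<in>U. \<exists>P\<in>U. \<exists>c :: 'u set \<Rightarrow> 'u. bij_betw c (Pow X) P)"


text \<open>
  A filter on the set \<open>X\<close> is a library filter \<open>F\<close> on the whole type that contains \<open>X\<close>, i.e.
  \<open>F \<le> principal X\<close>; it corresponds to the family of its members included in \<open>X\<close>.  The degenerate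
  filter is \<open>bot\<close>, and \<open>f[F]\<close> is \<open>filtermap f F\<close>.  Beware that the library order is reverse to
  inclusion of filters as families of sets: \<open>F \<le> G\<close> (library) says that \<open>F\<close> is finer than \<open>G\<close>, that
  is, that every member of \<open>G\<close> is a member of \<open>F\<close>.  Maps from \<open>X\<close> to \<open>Y\<close> are total functions in
  \<open>X \<rightarrow> Y\<close>; their values outside \<open>X\<close> never matter.
\<close>

definition members :: "'u filter \<Rightarrow> 'u set set" where
  "members F = {A. eventually (\<lambda>x. x \<in> A) F}"

definition filters_on :: "'u set \<Rightarrow> 'u filter set" where
  "filters_on X = {F. X \<in> members F}"

definition proper_filters_on :: "'u set \<Rightarrow> 'u filter set" where
  "proper_filters_on X = {F \<in> filters_on X. F \<noteq> bot}"

definition mesh :: "'u filter \<Rightarrow> 'u filter \<Rightarrow> bool" where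
  "mesh F G \<longleftrightarrow> (\<forall>A \<in> members F. \<forall>B \<in> members G. A \<inter> B \<noteq> {})"

definition generated_filter :: "'u set set \<Rightarrow> 'u filter" where
  "generated_filter \<A> = (INF A\<in>\<A>. principal A)"

definition relation_image :: "('u \<times> 'u) set \<Rightarrow> 'u filter \<Rightarrow> 'u filter" where
  "relation_image R F = generated_filter {R `` A | A. A \<in> members F}"

definition inverse_image :: "'u set \<Rightarrow> ('u \<Rightarrow> 'u) \<Rightarrow> 'u filter \<Rightarrow> 'u filter" where
  "inverse_image X f G = generated_filter {f -` B \<inter> X | B. B \<in> members G}"


type_synonym 'u filter_class = "'u set \<Rightarrow> 'u filter set"

definition F0_composable :: "'u set set \<Rightarrow> 'u filter_class \<Rightarrow> bool" where
  "F0_composable U \<DD> \<longleftrightarrow>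
     (\<forall>X\<in>U. \<DD> X \<subseteq> filters_on X) \<and>
     (\<forall>X\<in>U. \<forall>A. A \<subseteq> X \<longrightarrow> principal A \<in> \<DD> X) \<and>
     (\<forall>X\<in>U. \<forall>Y\<in>U. \<forall>R. R \<subseteq> X \<times> Y \<longrightarrow> (\<forall>D\<in>\<DD> X. relation_image R D \<in> \<DD> Y))"

definition refinable :: "'u set set \<Rightarrow> 'u filter_class \<Rightarrow> bool" where
  "refinable U \<DD> \<longleftrightarrow>
     (\<exists>Y\<in>U. \<forall>X\<in>U. \<forall>D\<in>\<DD> X. \<forall>F\<in>proper_filters_on X. mesh F D \<longrightarrow>
        (\<exists>L\<in>\<DD> X. L \<le> D \<and> mesh L F \<and>
           (\<exists>f\<in>X \<rightarrow> Y. inverse_image X f (filtermap f L) \<le> D)))"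


type_synonym 'u convergence = "('u \<times> 'u filter) set"

definition lim_of :: "'u convergence \<Rightarrow> 'u filter \<Rightarrow> 'u set" where
  "lim_of \<xi> F = {x. (x, F) \<in> \<xi>}"

definition convergence_on :: "'u set \<Rightarrow> 'u convergence \<Rightarrow> bool" where
  "convergence_on X \<xi> \<longleftrightarrow>
     \<xi> \<subseteq> X \<times> proper_filters_on X \<and>
     (\<forall>x\<in>X. x \<in> lim_of \<xi> (principal {x})) \<and>
     (\<forall>F\<in>proper_filters_on X. \<forall>G\<in>proper_filters_on X. G \<le> F \<longrightarrow> lim_of \<xi> F \<subseteq> lim_of \<xi> G)"

definition initial_convergence ::
    "'u set \<Rightarrow> ('u \<Rightarrow> 'u) \<Rightarrow> 'u convergence \<Rightarrow> 'u convergence" where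
  "initial_convergence X f \<tau> =
     {(x, F). x \<in> X \<and> F \<in> proper_filters_on X \<and> f x \<in> lim_of \<tau> (filtermap f F)}"

definition sup_convergence :: "'u set \<Rightarrow> 'u convergence set \<Rightarrow> 'u convergence" where
  "sup_convergence X \<Xi> =
     {(x, F). x \<in> X \<and> F \<in> proper_filters_on X \<and> (\<forall>\<xi>\<in>\<Xi>. x \<in> lim_of \<xi> F)}"

definition adherence :: "'u set \<Rightarrow> 'u convergence \<Rightarrow> 'u filter \<Rightarrow> 'u set" where
  "adherence X \<xi> H = (\<Union>G\<in>{G \<in> proper_filters_on X. G \<le> H}. lim_of \<xi> G)"

definition adh_modification ::
    "'u filter_class \<Rightarrow> 'u set \<Rightarrow> 'u convergence \<Rightarrow> 'u convergence" where
  "adh_modification \<DD> X \<xi> =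
     {(x, F). x \<in> X \<and> F \<in> proper_filters_on X \<and>
        (\<forall>D\<in>\<DD> X. mesh D F \<longrightarrow> x \<in> adherence X \<xi> D)}"

definition Conv :: "'u set set \<Rightarrow> ('u set \<times> 'u convergence) set" where
  "Conv U = {(X, \<xi>). X \<in> U \<and> convergence_on X \<xi>}"

text \<open>
  Simplicity of a full subcategory only depends on its objects, so subcategories are represented
  by their classes of objects: pairs of an underlying set and a convergence on it.
\<close>

definition fix_A :: "'u set set \<Rightarrow> 'u filter_class \<Rightarrow> ('u set \<times> 'u convergence) set" where
  "fix_A U \<DD> = {(X, \<xi>) \<in> Conv U. \<xi> = adh_modification \<DD> X \<xi>}"

definition initially_dense ::
    "'u set \<times> 'u convergence \<Rightarrow> ('u set \<times> 'u convergence) set \<Rightarrow> bool" where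
  "initially_dense Y\<eta> \<Phi> \<longleftrightarrow>
     Y\<eta> \<in> \<Phi> \<and>
     (\<forall>(X, \<xi>)\<in>\<Phi>. \<exists>A. A \<subseteq> (X \<rightarrow> fst Y\<eta>) \<and>
        \<xi> = sup_convergence X ((\<lambda>f. initial_convergence X f (snd Y\<eta>)) ` A))"

definition simple_in_Conv :: "('u set \<times> 'u convergence) set \<Rightarrow> bool" where
  "simple_in_Conv \<Phi> \<longleftrightarrow> (\<exists>Y\<eta>. initially_dense Y\<eta> \<Phi>)"

end

theory Submission
  imports Defs
begin

text \<open>
  A convergence is determined by \<open>\<DD>\<close>-adherences when every failure \<open>x \<notin> lim F\<close> is witnessed by some
  \<open>D \<in> \<DD>\<close> that meshes with \<open>F\<close> and does not adhere to \<open>x\<close>.  The universal examples are the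
  \<^emph>\<open>barrier convergences\<close>, in which a filter converges to \<open>z\<close> unless it meshes with one of the
  filters in a prescribed set \<open>N z \<subseteq> \<DD>\<close>; they are the test objects in both directions.

  Suppose that \<open>\<eta>\<close> on \<open>Y\<close> is initially dense, and let \<open>F\<close> mesh with \<open>D \<in> \<DD> X\<close>.  Add a point \<open>p\<close> to
  \<open>X\<close> and let exactly the filters that do not mesh with \<open>D\<close> converge to \<open>p\<close>.  As \<open>F\<close> does not
  converge to \<open>p\<close>, some continuous \<open>f\<close> into \<open>Y\<close> detects this, and the failure of \<open>f[F]\<close> to converge to
  \<open>f p\<close> is witnessed by some \<open>M \<in> \<DD> Y\<close>.  Continuity of \<open>f\<close> says that every proper filter finer than
  \<open>f\<^sup>-[M]\<close> meshes with \<open>D\<close>, which forces \<open>f\<^sup>-[M]\<close> to be finer than \<open>D\<close>.  So the saturated filter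
  \<open>f\<^sup>-[M]\<close> is the required refinement \<open>L\<close>, and the set \<open>Y\<close> does not depend on \<open>X\<close>, \<open>D\<close> and \<open>F\<close>.

  Conversely, let \<open>Y\<close> be the set given by refinability.  It allows every failure \<open>x \<notin> lim F\<close> in any
  object to be witnessed by a filter of the form \<open>f\<^sup>-[M]\<close> with \<open>f : X \<rightarrow> Y\<close> and \<open>M \<in> \<DD> Y\<close>.  The
  initially dense object consists of a copy of \<open>Y\<close>, to whose points every filter converges, and of
  one point \<open>p\<^sub>M\<close> for each \<open>M \<in> \<DD> Y\<close>, with barrier \<open>M\<close>.  Redefining \<open>f\<close> at the single point \<open>x\<close> to be
  \<open>p\<^sub>M\<close> gives a continuous map under which \<open>F\<close> still fails to converge.
\<close>

section \<open>Filters\<close>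

lemma members_iff: "A \<in> members F \<longleftrightarrow> eventually (\<lambda>x. x \<in> A) F"
  by (simp add: members_def)

lemma filters_on_iff: "F \<in> filters_on X \<longleftrightarrow> F \<le> principal X"
  by (simp add: filters_on_def members_iff le_principal)

lemma proper_filters_on_iff: "F \<in> proper_filters_on X \<longleftrightarrow> F \<le> principal X \<and> F \<noteq> bot"
  by (simp add: proper_filters_on_def filters_on_iff)

lemma proper_filters_on_finer:
  "F \<in> proper_filters_on X \<Longrightarrow> G \<le> F \<Longrightarrow> G \<noteq> bot \<Longrightarrow> G \<in> proper_filters_on X"
  using order_trans[of G F "principal X"] by (simp add: proper_filters_on_iff)

lemma proper_filters_on_superset:
  "F \<in> proper_filters_on X \<Longrightarrow> X \<subseteq> X' \<Longrightarrow> F \<in> proper_filters_on X'"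
  using order_trans[of F "principal X" "principal X'"] by (simp add: proper_filters_on_iff)

lemma proper_filters_on_filtermap:
  assumes "F \<in> proper_filters_on X" "f \<in> X \<rightarrow> Y"
  shows "filtermap f F \<in> proper_filters_on Y"
proof -
  have "eventually (\<lambda>x. x \<in> X) F" using assms(1) by (simp add: proper_filters_on_iff le_principal)
  then have "eventually (\<lambda>x. f x \<in> Y) F"
    by (rule eventually_mono) (use assms(2) in auto)
  then show ?thesis
    using assms(1) by (simp add: proper_filters_on_iff filtermap_bot_iff le_principal
        eventually_filtermap)
qed

lemma mesh_iff_inf_neq_bot: "mesh F G \<longleftrightarrow> inf F G \<noteq> bot"
proof
  assume m: "mesh F G"
  show "inf F G \<noteq> bot"
  proof
    assume "inf F G = bot"
    then obtain P Q where "eventually P F" "eventually Q G" "\<forall>x. P x \<and> Q x \<longrightarrow> False"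
      using eventually_inf[of "\<lambda>_. False" F G] by (auto simp: trivial_limit_def)
    then have "Collect P \<in> members F" "Collect Q \<in> members G" "Collect P \<inter> Collect Q = {}"
      by (auto simp: members_iff)
    then show False using m unfolding mesh_def by blast
  qed
next
  assume n: "inf F G \<noteq> bot"
  show "mesh F G"
    unfolding mesh_def
  proof (intro ballI notI)
    fix A B assume "A \<in> members F" "B \<in> members G" "A \<inter> B = {}"
    then have "eventually (\<lambda>_. False) (inf F G)"
      unfolding eventually_inf members_iff by blast
    with n show False by (simp add: trivial_limit_def)
  qed
qed

lemma inf_filtermap_eq_bot_iff:
  "inf (filtermap f F) G = bot \<longleftrightarrow> inf F (filtercomap f G) = bot"
proof -
  have "inf (filtermap f F) G = bot \<longleftrightarrow>
    (\<exists>P Q. eventually (\<lambda>x. P (f x)) F \<and> eventually Q G \<and> (\<forall>y. \<not> (P y \<and> Q y)))"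
    by (simp add: trivial_limit_def eventually_inf eventually_filtermap)
  also have "\<dots> \<longleftrightarrow> (\<exists>Q. eventually Q G \<and> eventually (\<lambda>x. \<not> Q (f x)) F)"
  proof safe
    fix P Q assume "eventually (\<lambda>x. P (f x)) F" "eventually Q G" "\<forall>y. \<not> (P y \<and> Q y)"
    then show "\<exists>Q. eventually Q G \<and> eventually (\<lambda>x. \<not> Q (f x)) F"
      by (intro exI[of _ Q]) (auto elim: eventually_mono)
  next
    fix Q assume "eventually Q G" "eventually (\<lambda>x. \<not> Q (f x)) F"
    then show "\<exists>P Q. eventually (\<lambda>x. P (f x)) F \<and> eventually Q G \<and> (\<forall>y. \<not> (P y \<and> Q y))"
      by (intro exI[of _ "\<lambda>y. \<not> Q y"] exI[of _ Q]) auto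
  qed
  also have "\<dots> \<longleftrightarrow> inf F (filtercomap f G) = bot"
  proof
    assume "\<exists>Q. eventually Q G \<and> eventually (\<lambda>x. \<not> Q (f x)) F"
    then obtain Q where Q: "eventually Q G" "eventually (\<lambda>x. \<not> Q (f x)) F" by blast
    have "eventually (\<lambda>x. Q (f x)) (filtercomap f G)"
      using Q(1) by (rule eventually_filtercomapI)
    then have "eventually (\<lambda>_. False) (inf F (filtercomap f G))"
      unfolding eventually_inf using Q(2) by blast
    then show "inf F (filtercomap f G) = bot" by (simp add: trivial_limit_def)
  next
    assume "inf F (filtercomap f G) = bot"
    then obtain P R where P: "eventually P F" "eventually R (filtercomap f G)"
      "\<forall>x. P x \<and> R x \<longrightarrow> False"
      using eventually_inf[of "\<lambda>_. False" F "filtercomap f G"] by (auto simp: trivial_limit_def)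
    then obtain Q where "eventually Q G" "\<forall>x. Q (f x) \<longrightarrow> R x"
      by (auto simp: eventually_filtercomap)
    with P show "\<exists>Q. eventually Q G \<and> eventually (\<lambda>x. \<not> Q (f x)) F"
      by (intro exI[of _ Q]) (auto elim!: eventually_mono)
  qed
  finally show ?thesis .
qed

lemma eventually_relation_image:
  "eventually P (relation_image R F) \<longleftrightarrow>
     (\<exists>A. eventually (\<lambda>x. x \<in> A) F \<and> (\<forall>y\<in>R `` A. P y))"
proof -
  have "eventually P (relation_image R F) \<longleftrightarrow>
    (\<exists>B\<in>{R `` A | A. A \<in> members F}. eventually P (principal B))"
    unfolding relation_image_def generated_filter_def
  proof (rule eventually_INF_base)
    have "UNIV \<in> members F" by (simp add: members_iff)
    then show "{R `` A | A. A \<in> members F} \<noteq> {}" by blast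
  next
    fix B C assume "B \<in> {R `` A | A. A \<in> members F}" "C \<in> {R `` A | A. A \<in> members F}"
    then obtain A A' where A: "B = R `` A" "C = R `` A'" "A \<in> members F" "A' \<in> members F"
      by auto
    then have "A \<inter> A' \<in> members F" by (simp add: members_iff eventually_conj)
    moreover have "principal (R `` (A \<inter> A')) \<le> inf (principal B) (principal C)"
      using A by auto
    ultimately show
      "\<exists>x\<in>{R `` A | A. A \<in> members F}. principal x \<le> inf (principal B) (principal C)"
      by blast
  qed
  then show ?thesis by (auto simp: members_iff eventually_principal)
qed

lemma relation_image_graph:
  assumes "F \<le> principal X"
  shows "relation_image {(x, f x) | x. x \<in> X} F = filtermap f F"
proof (rule filter_eqI)
  fix P
  have X: "eventually (\<lambda>x. x \<in> X) F" using assms by (simp add: le_principal)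
  show "eventually P (relation_image {(x, f x) | x. x \<in> X} F) \<longleftrightarrow> eventually P (filtermap f F)"
    unfolding eventually_relation_image eventually_filtermap
  proof
    assume "\<exists>A. eventually (\<lambda>x. x \<in> A) F \<and> (\<forall>y\<in>{(x, f x) | x. x \<in> X} `` A. P y)"
    then obtain A where A: "eventually (\<lambda>x. x \<in> A) F" "\<And>x. x \<in> A \<Longrightarrow> x \<in> X \<Longrightarrow> P (f x)"
      by blast
    show "eventually (\<lambda>x. P (f x)) F"
      using A(1) X by eventually_elim (rule A(2))
  next
    assume "eventually (\<lambda>x. P (f x)) F"
    then show "\<exists>A. eventually (\<lambda>x. x \<in> A) F \<and> (\<forall>y\<in>{(x, f x) | x. x \<in> X} `` A. P y)"
      by (intro exI[of _ "{x. P (f x)}"]) auto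
  qed
qed

lemma inverse_image_eq_relation_image:
  "inverse_image X f G = relation_image {(f x, x) | x. x \<in> X} G"
proof -
  have "{(f x, x) | x. x \<in> X} `` B = f -` B \<inter> X" for B by auto
  then show ?thesis by (simp add: inverse_image_def relation_image_def)
qed

lemma inverse_image_eq_filtercomap: "inverse_image X f G = inf (filtercomap f G) (principal X)"
proof (rule filter_eqI)
  fix P
  show "eventually P (inverse_image X f G) \<longleftrightarrow>
        eventually P (inf (filtercomap f G) (principal X))"
    unfolding inverse_image_eq_relation_image eventually_relation_image
      eventually_inf_principal eventually_filtercomap
  proof
    assume "\<exists>A. eventually (\<lambda>x. x \<in> A) G \<and> (\<forall>y\<in>{(f x, x) | x. x \<in> X} `` A. P y)"
    then show "\<exists>Q. eventually Q G \<and> (\<forall>x. Q (f x) \<longrightarrow> x \<in> X \<longrightarrow> P x)" by blast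
  next
    assume "\<exists>Q. eventually Q G \<and> (\<forall>x. Q (f x) \<longrightarrow> x \<in> X \<longrightarrow> P x)"
    then obtain Q where "eventually Q G" "\<forall>x. Q (f x) \<longrightarrow> x \<in> X \<longrightarrow> P x" by blast
    then show "\<exists>A. eventually (\<lambda>x. x \<in> A) G \<and> (\<forall>y\<in>{(f x, x) | x. x \<in> X} `` A. P y)"
      by (intro exI[of _ "Collect Q"]) auto
  qed
qed

lemma le_inverse_image_filtermap:
  assumes "L \<le> principal X"
  shows "L \<le> inverse_image X f (filtermap f L)"
  using assms filtermap_le_iff_le_filtercomap[of f L "filtermap f L"]
  by (simp add: inverse_image_eq_filtercomap)

text \<open>
  If \<open>F\<close> is not finer than \<open>D\<close>, then some \<open>A\<close> in \<open>D\<close> is not in \<open>F\<close>, and the trace of \<open>F\<close> on the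
  complement of \<open>A\<close> is a proper filter that misses \<open>D\<close>.
\<close>
lemma le_filter_if_finer_mesh:
  fixes F D :: "'a filter"
  assumes "\<And>G. G \<noteq> bot \<Longrightarrow> G \<le> F \<Longrightarrow> inf G D \<noteq> bot"
  shows "F \<le> D"
proof (rule filter_leI)
  fix P assume P: "eventually P D"
  let ?G = "inf F (principal {x. \<not> P x})"
  have "eventually (\<lambda>x. \<not> P x) ?G" by (simp add: eventually_inf_principal)
  then have "eventually (\<lambda>_. False) (inf ?G D)"
    unfolding eventually_inf[of _ ?G] using P by blast
  then have "?G = bot" using assms[of ?G] by (auto simp: trivial_limit_def)
  then have "eventually (\<lambda>_. False) ?G" by simp
  then show "eventually P F" unfolding eventually_inf_principal by simp
qed

section \<open>Small sets and composable classes\<close>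

lemma universe_singleton: "universe U \<Longrightarrow> {x} \<in> U"
  by (simp add: universe_def)

lemma universe_image: "universe U \<Longrightarrow> X \<in> U \<Longrightarrow> f ` X \<in> U"
  by (simp add: universe_def)

lemma universe_UN: "universe U \<Longrightarrow> X \<in> U \<Longrightarrow> (\<And>x. x \<in> X \<Longrightarrow> S x \<in> U) \<Longrightarrow> (\<Union>x\<in>X. S x) \<in> U"
  by (simp add: universe_def)

lemma universe_Pow:
  assumes "universe U" "X \<in> U"
  obtains P c where "P \<in> U" "bij_betw c (Pow X) P"
  using assms by (auto simp: universe_def)

lemma UNIV_notin_universe:
  fixes U :: "'u set set"
  assumes "universe U"
  shows "UNIV \<notin> U"
proof
  assume "UNIV \<in> U"
  then obtain P and c :: "'u set \<Rightarrow> 'u" where "bij_betw c (Pow UNIV) P"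
    using universe_Pow[OF assms] by metis
  then have "inj c" by (simp add: bij_betw_def)
  then have "range (inv c) = Pow UNIV" using inj_imp_surj_inv by auto
  then have "\<exists>h :: 'u \<Rightarrow> 'u set. range h = Pow UNIV" by blast
  with Cantors_theorem show False by (rule notE)
qed

text \<open>
  The powerset of a singleton provides a two-element set, over which a union of two sets can be
  indexed.
\<close>
lemma universe_insert:
  fixes U :: "'u set set"
  assumes U: "universe U" and X: "X \<in> U"
  shows "insert a X \<in> U"
proof (cases "X \<subseteq> {a}")
  case True
  then have "insert a X = {a}" by auto
  moreover have "{a} \<in> U" by (rule universe_singleton[OF U])
  ultimately show ?thesis by (simp only:)
next
  case False
  then obtain x where x: "x \<in> X" "x \<noteq> a" by auto
  have "{x} \<in> U" by (rule universe_singleton[OF U])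
  then obtain P and c :: "'u set \<Rightarrow> 'u" where P: "P \<in> U" and c: "bij_betw c (Pow {x}) P"
    by (rule universe_Pow[OF U])
  have "P = {c {}, c {x}}" using c by (auto simp: bij_betw_def Pow_insert)
  moreover have "c {} \<noteq> c {x}" using c by (auto simp: bij_betw_def inj_on_def)
  ultimately have "(\<lambda>t. if t = c {} then a else x) ` P = {a, x}" by auto
  then have ax: "{a, x} \<in> U" using universe_image[OF U P] by metis
  have "{a} \<in> U" by (rule universe_singleton[OF U])
  then have "(\<Union>t\<in>{a, x}. if t = a then {a} else X) \<in> U"
    by (intro universe_UN[OF U ax]) (simp add: X)
  then show ?thesis using x by simp
qed

text \<open>
  A filter on \<open>Y\<close> is a family of subsets of \<open>Y\<close>, so two applications of the powerset axiom make
  room for codes of all filters on \<open>Y\<close>.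
\<close>
lemma universe_code_Pow_Pow:
  fixes U :: "'u set set"
  assumes U: "universe U" and Y: "Y \<in> U"
  obtains Z and c :: "'u set set \<Rightarrow> 'u"
    where "Z \<in> U" "inj_on c (Pow (Pow Y))" "c ` Pow (Pow Y) \<subseteq> Z"
proof -
  obtain P and b :: "'u set \<Rightarrow> 'u" where P: "P \<in> U" and b: "bij_betw b (Pow Y) P"
    using universe_Pow[OF U Y] by metis
  obtain Q and d :: "'u set \<Rightarrow> 'u" where Q: "Q \<in> U" and d: "bij_betw d (Pow P) Q"
    using universe_Pow[OF U P] by metis
  have "bij_betw ((`) b) (Pow (Pow Y)) (Pow P)"
    using b by (rule bij_betw_Pow)
  then have "bij_betw (d \<circ> (`) b) (Pow (Pow Y)) Q"
    using d by (rule bij_betw_trans)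
  then show thesis
    using Q that[of Q "d \<circ> (`) b"] by (simp add: bij_betw_def)
qed

lemma F0_composable_le_principal:
  "F0_composable U \<DD> \<Longrightarrow> X \<in> U \<Longrightarrow> D \<in> \<DD> X \<Longrightarrow> D \<le> principal X"
  by (auto simp: F0_composable_def filters_on_iff[symmetric])

lemma F0_composable_relation_image:
  "F0_composable U \<DD> \<Longrightarrow> X \<in> U \<Longrightarrow> Y \<in> U \<Longrightarrow> D \<in> \<DD> X \<Longrightarrow> R \<subseteq> X \<times> Y \<Longrightarrow>
   relation_image R D \<in> \<DD> Y"
  by (simp add: F0_composable_def)

lemma F0_composable_filtermap:
  assumes "F0_composable U \<DD>" "X \<in> U" "Y \<in> U" "D \<in> \<DD> X" "f \<in> X \<rightarrow> Y"
  shows "filtermap f D \<in> \<DD> Y"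
proof -
  have "relation_image {(x, f x) | x. x \<in> X} D \<in> \<DD> Y"
    using assms(5) by (intro F0_composable_relation_image[OF assms(1-4)]) auto
  then show ?thesis
    by (simp only: relation_image_graph[OF F0_composable_le_principal[OF assms(1,2,4)]])
qed

lemma F0_composable_inverse_image:
  assumes "F0_composable U \<DD>" "X \<in> U" "Y \<in> U" "M \<in> \<DD> Y" "f \<in> X \<rightarrow> Y"
  shows "inverse_image X f M \<in> \<DD> X"
  unfolding inverse_image_eq_relation_image
  using assms(5) by (intro F0_composable_relation_image[OF assms(1,3,2,4)]) auto

section \<open>Barrier convergences\<close>

lemma convergence_on_finer:
  assumes "convergence_on X \<xi>" "(x, F) \<in> \<xi>" "G \<le> F" "G \<noteq> bot"
  shows "(x, G) \<in> \<xi>"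
proof -
  have F: "F \<in> proper_filters_on X" using assms unfolding convergence_on_def by blast
  then have "G \<in> proper_filters_on X" using assms(3,4) by (rule proper_filters_on_finer)
  with F show ?thesis
    using assms unfolding convergence_on_def lim_of_def by blast
qed

lemma convergence_subset_adh_modification:
  assumes "convergence_on X \<xi>"
  shows "\<xi> \<subseteq> adh_modification \<DD> X \<xi>"
proof
  fix p assume "p \<in> \<xi>"
  then obtain x F where p: "p = (x, F)" and xF: "(x, F) \<in> \<xi>" by (cases p) auto
  have x: "x \<in> X" and F: "F \<in> proper_filters_on X"
    using xF assms unfolding convergence_on_def by auto
  have "x \<in> adherence X \<xi> D" if "mesh D F" for D
  proof -
    have n: "inf D F \<noteq> bot" using that by (simp add: mesh_iff_inf_neq_bot)
    have "(x, inf D F) \<in> \<xi>" by (rule convergence_on_finer[OF assms xF]) (auto simp: n)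
    moreover have "inf D F \<in> proper_filters_on X"
      using F n unfolding proper_filters_on_iff by (auto intro: le_infI2)
    ultimately show ?thesis unfolding adherence_def lim_of_def by fastforce
  qed
  then show "p \<in> adh_modification \<DD> X \<xi>"
    using x F by (simp add: p adh_modification_def)
qed

definition barrier_convergence :: "'u set \<Rightarrow> ('u \<Rightarrow> 'u filter set) \<Rightarrow> 'u convergence" where
  "barrier_convergence Z N =
     {(z, G). z \<in> Z \<and> G \<in> proper_filters_on Z \<and> (\<forall>M\<in>N z. inf G M = bot)}"

text \<open>
  A filter stopped by the barrier \<open>M\<close> at \<open>z\<close> meshes with \<open>M \<in> \<DD>\<close>, whereas no filter finer than \<open>M\<close>
  converges to \<open>z\<close>; hence the barrier itself is the adherence witness.
\<close>
lemma barrier_convergence_in_fix_A: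
  assumes Z: "Z \<in> U"
    and N: "\<And>z. z \<in> Z \<Longrightarrow> N z \<subseteq> \<DD> Z"
    and apart: "\<And>z M. z \<in> Z \<Longrightarrow> M \<in> N z \<Longrightarrow> inf (principal {z}) M = bot"
  shows "(Z, barrier_convergence Z N) \<in> fix_A U \<DD>"
proof -
  let ?\<xi> = "barrier_convergence Z N"
  have conv: "convergence_on Z ?\<xi>"
    unfolding convergence_on_def
  proof (intro conjI ballI impI)
    show "?\<xi> \<subseteq> Z \<times> proper_filters_on Z" by (auto simp: barrier_convergence_def)
  next
    fix z assume "z \<in> Z"
    then show "z \<in> lim_of ?\<xi> (principal {z})"
      using apart by (auto simp: lim_of_def barrier_convergence_def proper_filters_on_iff
          principal_eq_bot_iff)
  next
    fix F G assume G: "G \<in> proper_filters_on Z" "G \<le> F"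
    show "lim_of ?\<xi> F \<subseteq> lim_of ?\<xi> G"
    proof
      fix z assume "z \<in> lim_of ?\<xi> F"
      then have z: "z \<in> Z" and *: "\<And>M. M \<in> N z \<Longrightarrow> inf F M = bot"
        by (auto simp: lim_of_def barrier_convergence_def)
      have "inf G M = bot" if "M \<in> N z" for M
        using inf_mono[OF G(2) order_refl[of M]] *[OF that] by (simp add: bot_unique)
      then show "z \<in> lim_of ?\<xi> G"
        using z G by (simp add: lim_of_def barrier_convergence_def)
    qed
  qed
  have "adh_modification \<DD> Z ?\<xi> \<subseteq> ?\<xi>"
  proof
    fix p assume p: "p \<in> adh_modification \<DD> Z ?\<xi>"
    then obtain z F where pz: "p = (z, F)" by (cases p) auto
    have z: "z \<in> Z" and F: "F \<in> proper_filters_on Z"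
      and adh: "\<And>M. M \<in> \<DD> Z \<Longrightarrow> mesh M F \<Longrightarrow> z \<in> adherence Z ?\<xi> M"
      using p unfolding pz adh_modification_def by auto
    have "inf F M = bot" if M: "M \<in> N z" for M
    proof (rule ccontr)
      assume "inf F M \<noteq> bot"
      then have "z \<in> adherence Z ?\<xi> M"
        using adh[of M] M N[OF z] by (auto simp: mesh_iff_inf_neq_bot inf_commute)
      then obtain G where "G \<noteq> bot" "G \<le> M" "(z, G) \<in> ?\<xi>"
        by (auto simp: adherence_def lim_of_def proper_filters_on_iff)
      then show False
        using M by (auto simp: barrier_convergence_def inf.absorb1)
    qed
    then show "p \<in> ?\<xi>" using z F by (simp add: pz barrier_convergence_def)
  qed
  with convergence_subset_adh_modification[OF conv] have "?\<xi> = adh_modification \<DD> Z ?\<xi>"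
    by blast
  then show ?thesis
    using conv Z by (simp add: fix_A_def Conv_def)
qed

section \<open>Simplicity implies refinability\<close>

text \<open>
  The witnessing filter is pulled back along a map that is continuous at a new point \<open>p\<close> to which
  exactly the filters not meshing with \<open>D\<close> converge.
\<close>
lemma initially_dense_imp_refinement:
  assumes U: "universe U" and comp: "F0_composable U \<DD>"
    and dense: "initially_dense (Y, \<eta>) (fix_A U \<DD>)"
    and X: "X \<in> U" and D: "D \<in> \<DD> X" and F: "F \<in> proper_filters_on X" and FD: "mesh F D"
  shows "\<exists>L\<in>\<DD> X. L \<le> D \<and> mesh L F \<and> (\<exists>f\<in>X \<rightarrow> Y. inverse_image X f (filtermap f L) \<le> D)"
proof -
  have \<eta>: "(Y, \<eta>) \<in> fix_A U \<DD>" using dense by (simp add: initially_dense_def)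
  then have Y: "Y \<in> U" and \<eta>_eq: "\<eta> = adh_modification \<DD> Y \<eta>"
    by (auto simp: fix_A_def Conv_def)
  have "X \<noteq> UNIV" using UNIV_notin_universe[OF U] X by blast
  then obtain p where p: "p \<notin> X" by blast
  define X' where "X' = insert p X"
  have X': "X' \<in> U" unfolding X'_def using U X by (rule universe_insert)
  have DX: "D \<le> principal X" using F0_composable_le_principal[OF comp X D] .
  have FX: "F \<le> principal X" "F \<noteq> bot" using F by (auto simp: proper_filters_on_iff)
  have XX': "X \<subseteq> X'" by (auto simp: X'_def)
  have "filtermap (\<lambda>x. x) D \<in> \<DD> X'"
    by (rule F0_composable_filtermap[OF comp X X' D]) (auto simp: X'_def)
  then have DX': "D \<in> \<DD> X'" by (simp add: filtermap_ident)
  define \<xi> where "\<xi> = barrier_convergence X' (\<lambda>z. if z = p then {D} else {})"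
  have "inf (principal {p}) D \<le> inf (principal {p}) (principal X)"
    using DX by (rule inf_mono[OF order_refl])
  then have apart: "inf (principal {p}) D = bot" using p by (simp add: bot_unique)
  have "(X', \<xi>) \<in> fix_A U \<DD>"
    unfolding \<xi>_def using X' DX' apart
    by (intro barrier_convergence_in_fix_A) (auto split: if_splits)
  then obtain A where A: "A \<subseteq> X' \<rightarrow> Y"
    and \<xi>_eq: "\<xi> = sup_convergence X' ((\<lambda>f. initial_convergence X' f \<eta>) ` A)"
    using conjunct2[OF dense[unfolded initially_dense_def], THEN bspec, of "(X', \<xi>)"] by auto
  have lim_p: "(p, G) \<in> \<xi> \<longleftrightarrow> G \<le> principal X' \<and> G \<noteq> bot \<and> inf G D = bot" for G
    by (auto simp: \<xi>_def barrier_convergence_def proper_filters_on_iff X'_def)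
  have "(p, F) \<notin> \<xi>" using FD by (simp add: lim_p mesh_iff_inf_neq_bot)
  moreover have "F \<in> proper_filters_on X'"
    using F XX' by (rule proper_filters_on_superset)
  moreover have pX': "p \<in> X'" by (simp add: X'_def)
  ultimately obtain f where f: "f \<in> A" and "f p \<notin> lim_of \<eta> (filtermap f F)"
    unfolding \<xi>_eq by (auto simp: sup_convergence_def initial_convergence_def lim_of_def)
  moreover have fY: "f \<in> X' \<rightarrow> Y" using f A by blast
  moreover have "filtermap f F \<in> proper_filters_on Y"
    using \<open>F \<in> proper_filters_on X'\<close> fY by (rule proper_filters_on_filtermap)
  moreover have "f p \<in> Y" using fY pX' by (rule funcset_mem)
  moreover have "lim_of \<eta> (filtermap f F) = lim_of (adh_modification \<DD> Y \<eta>) (filtermap f F)"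
    by (simp only: \<eta>_eq[symmetric])
  ultimately obtain M where M: "M \<in> \<DD> Y" and MF: "mesh M (filtermap f F)"
    and nadh: "f p \<notin> adherence Y \<eta> M"
    by (auto simp: lim_of_def adh_modification_def)
  have fXY: "f \<in> X \<rightarrow> Y" using fY by (auto simp: X'_def)
  define L where "L = inverse_image X f M"
  have L: "L \<in> \<DD> X" unfolding L_def by (rule F0_composable_inverse_image[OF comp X Y M fXY])
  have LX: "L \<le> principal X" by (simp add: L_def inverse_image_eq_filtercomap)
  have "L \<le> D"
  proof (rule le_filter_if_finer_mesh)
    fix G assume G: "G \<noteq> bot" "G \<le> L"
    then have GX: "G \<in> proper_filters_on X"
      using order_trans[OF G(2) LX] by (simp add: proper_filters_on_iff)
    show "inf G D \<noteq> bot"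
    proof
      assume "inf G D = bot"
      then have "(p, G) \<in> \<xi>"
        using proper_filters_on_superset[OF GX XX'] by (simp add: lim_p proper_filters_on_iff)
      \<comment> \<open>continuity of \<open>f\<close> at \<open>p\<close>\<close>
      then have "f p \<in> lim_of \<eta> (filtermap f G)"
        using f unfolding \<xi>_eq
        by (auto simp: sup_convergence_def initial_convergence_def lim_of_def)
      moreover have "filtermap f G \<in> proper_filters_on Y"
        using GX fXY by (rule proper_filters_on_filtermap)
      moreover have "filtermap f G \<le> M"
        using G(2) unfolding L_def inverse_image_eq_filtercomap
        by (simp add: filtermap_le_iff_le_filtercomap)
      ultimately show False using nadh by (auto simp: adherence_def)
    qed
  qed
  moreover have "mesh L F"
  proof -
    have "inf (principal X) F = F" using FX by (simp add: inf.absorb2)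
    then have "inf L F = inf (filtercomap f M) F"
      by (simp add: L_def inverse_image_eq_filtercomap inf.assoc)
    then have "inf L F = inf F (filtercomap f M)" by (simp only: inf_commute)
    moreover have "inf (filtermap f F) M \<noteq> bot"
      using MF by (simp add: mesh_iff_inf_neq_bot inf_commute)
    ultimately show ?thesis by (simp add: mesh_iff_inf_neq_bot inf_filtermap_eq_bot_iff)
  qed
  moreover have "inverse_image X f (filtermap f L) \<le> D"
  proof -
    have "filtermap f L \<le> M"
      unfolding L_def inverse_image_eq_filtercomap by (simp add: filtermap_le_iff_le_filtercomap)
    then have "inverse_image X f (filtermap f L) \<le> L"
      unfolding L_def inverse_image_eq_filtercomap by (intro inf_mono filtercomap_mono) auto
    with \<open>L \<le> D\<close> show ?thesis by (rule order_trans[rotated])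
  qed
  ultimately show ?thesis using L fXY by blast
qed

section \<open>Refinability implies simplicity\<close>

text \<open>
  The point standing for \<open>M\<close> codes the ideal dual to \<open>M\<close> rather than \<open>M\<close> itself: an ideal always
  contains the empty set, which keeps these codes apart from the codes \<open>{{y}}\<close> of points of \<open>Y\<close>.
\<close>
definition dual_ideal :: "'u set \<Rightarrow> 'u filter \<Rightarrow> 'u set set" where
  "dual_ideal Y M = {A. A \<subseteq> Y \<and> eventually (\<lambda>y. y \<notin> A) M}"

lemma dual_ideal_inject:
  assumes "M \<le> principal Y" "M' \<le> principal Y" "dual_ideal Y M = dual_ideal Y M'"
  shows "M = M'"
proof (rule filter_eqI)
  fix P
  have *: "eventually P K \<longleftrightarrow> {y \<in> Y. \<not> P y} \<in> dual_ideal Y K" if "K \<le> principal Y" for K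
  proof -
    have "eventually (\<lambda>y. y \<in> Y) K" using that by (simp add: le_principal)
    then have "eventually P K \<longleftrightarrow> eventually (\<lambda>y. \<not> (y \<in> Y \<and> \<not> P y)) K"
      by (intro eventually_cong[of "\<lambda>y. y \<in> Y"]) auto
    then show ?thesis by (simp add: dual_ideal_def)
  qed
  show "eventually P M \<longleftrightarrow> eventually P M'" using *[OF assms(1)] *[OF assms(2)] assms(3) by simp
qed

text \<open>
  Changing \<open>f\<close> at a point \<open>x\<close> whose image escapes some member of \<open>M\<close> does not change the inverse
  image of \<open>M\<close>, since that member can be used to cut \<open>x\<close> away.
\<close>
lemma inverse_image_redefine:
  assumes MY: "M \<le> principal Y" and i: "inj_on i Y" and f: "f \<in> X \<rightarrow> Y"
    and B: "eventually (\<lambda>y. y \<in> B) M" "f x \<notin> B" and q: "q \<notin> i ` Y"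
  shows "inverse_image X (\<lambda>t. if t = x then q else i (f t)) (filtermap i M) = inverse_image X f M"
    (is "inverse_image X ?g _ = _")
proof (rule filter_eqI)
  fix P
  have Y: "eventually (\<lambda>y. y \<in> Y) M" using MY by (simp add: le_principal)
  show "eventually P (inverse_image X ?g (filtermap i M)) \<longleftrightarrow> eventually P (inverse_image X f M)"
    unfolding inverse_image_eq_filtercomap eventually_inf_principal eventually_filtercomap
      eventually_filtermap
  proof
    assume "\<exists>Q. eventually (\<lambda>y. Q (i y)) M \<and> (\<forall>t. Q (?g t) \<longrightarrow> t \<in> X \<longrightarrow> P t)"
    then obtain Q where Q: "eventually (\<lambda>y. Q (i y)) M"
      "\<And>t. Q (?g t) \<Longrightarrow> t \<in> X \<Longrightarrow> P t" by blast
    have "eventually (\<lambda>y. Q (i y) \<and> y \<in> B) M" using Q(1) B(1) by (rule eventually_conj)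
    moreover have "P t" if t: "Q (i (f t)) \<and> f t \<in> B" "t \<in> X" for t
    proof -
      have "t \<noteq> x" using t(1) B(2) by blast
      then show ?thesis using t Q(2)[of t] by simp
    qed
    ultimately show "\<exists>Q. eventually Q M \<and> (\<forall>t. Q (f t) \<longrightarrow> t \<in> X \<longrightarrow> P t)"
      by (intro exI[of _ "\<lambda>y. Q (i y) \<and> y \<in> B"]) blast
  next
    assume "\<exists>Q. eventually Q M \<and> (\<forall>t. Q (f t) \<longrightarrow> t \<in> X \<longrightarrow> P t)"
    then obtain Q where Q: "eventually Q M" "\<And>t. Q (f t) \<Longrightarrow> t \<in> X \<Longrightarrow> P t" by blast
    define R where "R z \<longleftrightarrow> (\<exists>y\<in>Y. z = i y \<and> Q y)" for z
    have "eventually (\<lambda>y. R (i y)) M"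
      using Q(1) Y by eventually_elim (auto simp: R_def)
    moreover have "P t" if t: "R (?g t)" "t \<in> X" for t
    proof -
      obtain y where y: "y \<in> Y" "?g t = i y" "Q y" using t(1) unfolding R_def by blast
      then have "t \<noteq> x" using q by auto
      then have "f t = y" using y t f inj_onD[OF i] by (auto simp: Pi_iff)
      then show ?thesis using y t Q(2) by blast
    qed
    ultimately show "\<exists>Q. eventually (\<lambda>y. Q (i y)) M \<and> (\<forall>t. Q (?g t) \<longrightarrow> t \<in> X \<longrightarrow> P t)"
      by (intro exI[of _ R]) blast
  qed
qed

text \<open>
  The universal object: \<open>i\<close> embeds \<open>Y\<close>, and \<open>j M\<close> is the point with barrier \<open>M\<close>.
\<close>
lemma refinable_imp_simple:
  fixes U :: "'u set set" and \<DD> :: "'u filter_class"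
  assumes U: "universe U" and comp: "F0_composable U \<DD>" and ref: "refinable U \<DD>"
  shows "simple_in_Conv (fix_A U \<DD>)"
proof -
  obtain Y where Y: "Y \<in> U" and refine:
    "\<And>X D F. X \<in> U \<Longrightarrow> D \<in> \<DD> X \<Longrightarrow> F \<in> proper_filters_on X \<Longrightarrow> mesh F D \<Longrightarrow>
        \<exists>L\<in>\<DD> X. L \<le> D \<and> mesh L F \<and> (\<exists>f\<in>X \<rightarrow> Y. inverse_image X f (filtermap f L) \<le> D)"
    using ref unfolding refinable_def by blast
  obtain Z and c :: "'u set set \<Rightarrow> 'u" where Z: "Z \<in> U"
    and c: "inj_on c (Pow (Pow Y))" and cZ: "c ` Pow (Pow Y) \<subseteq> Z"
    using universe_code_Pow_Pow[OF U Y] .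
  define i where "i y = c {{y}}" for y
  define j where "j M = c (dual_ideal Y M)" for M
  have dual_sub: "dual_ideal Y M \<in> Pow (Pow Y)" for M by (auto simp: dual_ideal_def)
  have i_inj: "inj_on i Y" using c by (auto simp: inj_on_def i_def)
  have iZ: "i \<in> Y \<rightarrow> Z" using cZ by (auto simp: i_def)
  have jZ: "j M \<in> Z" for M using cZ dual_sub by (auto simp: j_def)
  have j_inj: "M = M'" if "M \<in> \<DD> Y" "M' \<in> \<DD> Y" "j M = j M'" for M M'
  proof (rule dual_ideal_inject)
    show "M \<le> principal Y" "M' \<le> principal Y"
      using that F0_composable_le_principal[OF comp Y] by auto
    show "dual_ideal Y M = dual_ideal Y M'"
      using inj_onD[OF c _ dual_sub dual_sub] that(3) by (simp add: j_def)
  qed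
  have ji: "j M \<notin> i ` Y" for M
  proof
    assume "j M \<in> i ` Y"
    then obtain y where "y \<in> Y" "c (dual_ideal Y M) = c {{y}}" by (auto simp: i_def j_def)
    then have "dual_ideal Y M = {{y}}" by (intro inj_onD[OF c _ dual_sub]) auto
    moreover have "{} \<in> dual_ideal Y M" by (simp add: dual_ideal_def)
    ultimately show False by simp
  qed
  define N where "N z = {filtermap i M | M. M \<in> \<DD> Y \<and> z = j M}" for z
  define \<eta> where "\<eta> = barrier_convergence Z N"
  have "inf (principal {j M}) (filtermap i M') = bot" if "M' \<in> \<DD> Y" for M M'
  proof -
    have "filtermap i M' \<le> principal (i ` Y)"
      using F0_composable_le_principal[OF comp Y that] filtermap_mono[of M' "principal Y" i]
      by (simp add: filtermap_principal)
    then have "inf (principal {j M}) (filtermap i M') \<le> inf (principal {j M}) (principal (i ` Y))"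
      by (rule inf_mono[OF order_refl])
    then show ?thesis using ji by (simp add: bot_unique)
  qed
  then have \<eta>_fix: "(Z, \<eta>) \<in> fix_A U \<DD>"
    unfolding \<eta>_def using F0_composable_filtermap[OF comp Y Z _ iZ]
    by (intro barrier_convergence_in_fix_A Z) (auto simp: N_def)
  have dense: "\<exists>A. A \<subseteq> X \<rightarrow> Z \<and>
      \<xi> = sup_convergence X ((\<lambda>f. initial_convergence X f \<eta>) ` A)" if "(X, \<xi>) \<in> fix_A U \<DD>" for X \<xi>
  proof -
    have X: "X \<in> U" and conv: "convergence_on X \<xi>" and \<xi>_eq: "\<xi> = adh_modification \<DD> X \<xi>"
      using that by (auto simp: fix_A_def Conv_def)
    define A where "A = {g \<in> X \<rightarrow> Z. \<forall>(x, G)\<in>\<xi>. g x \<in> lim_of \<eta> (filtermap g G)}"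
    have sub: "\<xi> \<subseteq> sup_convergence X ((\<lambda>f. initial_convergence X f \<eta>) ` A)"
      using conv unfolding convergence_on_def
      by (auto simp: sup_convergence_def initial_convergence_def A_def lim_of_def)
    have in_\<xi>: "(x, F) \<in> \<xi>" if x: "x \<in> X" and F: "F \<in> proper_filters_on X"
      and all: "\<And>g. g \<in> A \<Longrightarrow> g x \<in> lim_of \<eta> (filtermap g F)" for x F
    proof (rule ccontr)
      assume "(x, F) \<notin> \<xi>"
      then have "(x, F) \<notin> adh_modification \<DD> X \<xi>"
        by (simp only: \<xi>_eq[symmetric] not_False_eq_True)
      with x F obtain D where D: "D \<in> \<DD> X" and DF: "mesh D F"
        and nadh: "x \<notin> adherence X \<xi> D"
        by (auto simp: adh_modification_def)
      have no_lim: "(x, G) \<notin> \<xi>" if "G \<le> D" for G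
        using nadh that conv unfolding adherence_def lim_of_def convergence_on_def by blast
      have "mesh F D" using DF by (simp add: mesh_iff_inf_neq_bot inf_commute)
      then obtain L f where L: "L \<in> \<DD> X" "mesh L F" and f: "f \<in> X \<rightarrow> Y"
        and fLD: "inverse_image X f (filtermap f L) \<le> D"
        using refine[OF X D F] by blast
      define M where "M = filtermap f L"
      define K where "K = inverse_image X f M"
      have M: "M \<in> \<DD> Y" unfolding M_def by (rule F0_composable_filtermap[OF comp X Y L(1) f])
      have KD: "K \<le> D" using fLD by (simp add: K_def M_def)
      have "L \<le> K"
        unfolding K_def M_def
        using F0_composable_le_principal[OF comp X L(1)] by (rule le_inverse_image_filtermap)
      have "inf F L \<noteq> bot" using L(2) by (simp add: mesh_iff_inf_neq_bot inf_commute)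
      moreover have "inf F L \<le> inf F K" using \<open>L \<le> K\<close> by (rule inf_mono[OF order_refl])
      ultimately have KF: "inf F K \<noteq> bot" by (metis bot_unique)
      \<comment> \<open>otherwise the principal ultrafilter of \<open>x\<close> would be finer than \<open>K\<close>, hence than \<open>D\<close>\<close>
      have "\<exists>B. eventually (\<lambda>y. y \<in> B) M \<and> f x \<notin> B"
      proof (rule ccontr)
        assume none: "\<nexists>B. eventually (\<lambda>y. y \<in> B) M \<and> f x \<notin> B"
        have "P (f x)" if "eventually P M" for P
          using none[unfolded not_ex, rule_format, of "Collect P"] that by simp
        then have "filtermap f (principal {x}) \<le> M"
          by (auto simp: le_filter_def eventually_principal)
        then have "principal {x} \<le> filtercomap f M"
          by (simp only: filtermap_le_iff_le_filtercomap)
        then have "principal {x} \<le> K"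
          using x by (simp add: K_def inverse_image_eq_filtercomap)
        then have "(x, principal {x}) \<notin> \<xi>" using KD by (rule no_lim[OF order_trans])
        then show False using conv x by (simp add: convergence_on_def lim_of_def)
      qed
      then obtain B where B: "eventually (\<lambda>y. y \<in> B) M" "f x \<notin> B" by blast
      define g where "g = (\<lambda>t. if t = x then j M else i (f t))"
      have gZ: "g \<in> X \<rightarrow> Z" using iZ f jZ by (auto simp: g_def)
      have gK: "inverse_image X g (filtermap i M) = K"
        unfolding g_def K_def
        by (rule inverse_image_redefine[OF F0_composable_le_principal[OF comp Y M] i_inj f B ji])
      have stop: "inf (filtermap g G) (filtermap i M) = bot \<longleftrightarrow> inf G K = bot"
        if "G \<le> principal X" for G
      proof -
        have "inf G K = inf G (filtercomap g (filtermap i M))"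
          by (simp only: gK[symmetric] inverse_image_eq_filtercomap inf_commute[of G] inf_assoc
              inf.absorb2[OF that])
        then show ?thesis by (simp add: inf_filtermap_eq_bot_iff)
      qed
      have "g \<in> A"
        unfolding A_def
      proof (intro CollectI conjI gZ ballI, clarify)
        fix t G assume tG: "(t, G) \<in> \<xi>"
        then have t: "t \<in> X" and G: "G \<le> principal X" "G \<noteq> bot"
          using conv by (auto simp: convergence_on_def proper_filters_on_iff)
        have "filtermap g G \<in> proper_filters_on Z"
          using G gZ by (intro proper_filters_on_filtermap) (auto simp: proper_filters_on_iff)
        moreover have "inf (filtermap g G) M'' = bot" if "M'' \<in> N (g t)" for M''
        proof -
          from that obtain M' where M': "M'' = filtermap i M'" "M' \<in> \<DD> Y" "g t = j M'"
            unfolding N_def by blast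
          have "t = x"
          proof (rule ccontr)
            assume "t \<noteq> x"
            then have "g t \<in> i ` Y" using t f by (auto simp: g_def)
            then show False unfolding M'(3) using ji by (rule notE[rotated])
          qed
          then have "M' = M" using M'(3) by (intro j_inj[OF M'(2) M]) (simp add: g_def)
          have "inf G K = bot"
          proof (rule ccontr)
            assume "inf G K \<noteq> bot"
            then have "(x, inf G K) \<in> \<xi>"
              using convergence_on_finer[OF conv tG, of "inf G K"] \<open>t = x\<close> by simp
            moreover have "(x, inf G K) \<notin> \<xi>" using KD by (intro no_lim le_infI2)
            ultimately show False by simp
          qed
          then show ?thesis using stop[OF G(1)] \<open>M' = M\<close> M'(1) by simp
        qed
        ultimately show "g t \<in> lim_of \<eta> (filtermap g G)"
          using gZ t by (auto simp: lim_of_def \<eta>_def barrier_convergence_def)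
      qed
      then have "j M \<in> lim_of \<eta> (filtermap g F)" using all[of g] by (simp add: g_def)
      then have "inf (filtermap g F) (filtermap i M) = bot"
        using M by (auto simp: lim_of_def \<eta>_def barrier_convergence_def N_def)
      then show False using stop KF F by (simp add: proper_filters_on_iff)
    qed
    have "sup_convergence X ((\<lambda>f. initial_convergence X f \<eta>) ` A) \<subseteq> \<xi>"
    proof
      fix p assume "p \<in> sup_convergence X ((\<lambda>f. initial_convergence X f \<eta>) ` A)"
      then obtain x F where "p = (x, F)" "x \<in> X" "F \<in> proper_filters_on X"
        and "\<forall>g\<in>A. g x \<in> lim_of \<eta> (filtermap g F)"
        by (auto simp: sup_convergence_def initial_convergence_def lim_of_def)
      then show "p \<in> \<xi>" using in_\<xi> by simp
    qed
    with sub have "\<xi> = sup_convergence X ((\<lambda>f. initial_convergence X f \<eta>) ` A)" by blast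
    moreover have "A \<subseteq> X \<rightarrow> Z" by (auto simp: A_def)
    ultimately show ?thesis by blast
  qed
  have "initially_dense (Z, \<eta>) (fix_A U \<DD>)"
    unfolding initially_dense_def using \<eta>_fix dense by auto
  then show ?thesis unfolding simple_in_Conv_def by blast
qed

theorem theorem8:
  fixes U :: "'u set set" and \<DD> :: "'u set \<Rightarrow> 'u filter set"
  assumes "universe U" and "F0_composable U \<DD>"
  shows "simple_in_Conv (fix_A U \<DD>) \<longleftrightarrow> refinable U \<DD>"
proof
  assume "simple_in_Conv (fix_A U \<DD>)"
  then obtain Y \<eta> where dense: "initially_dense (Y, \<eta>) (fix_A U \<DD>)"
    unfolding simple_in_Conv_def by auto
  then have "Y \<in> U" by (auto simp: initially_dense_def fix_A_def Conv_def)
  then show "refinable U \<DD>"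
    using initially_dense_imp_refinement[OF assms dense] unfolding refinable_def by blast
next
  assume "refinable U \<DD>"
  with assms show "simple_in_Conv (fix_A U \<DD>)" by (rule refinable_imp_simple)
qed

end
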